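(* Let $\mathfrak g$ be a nonzero complete left-symmetric algebra over $\mathbb C$ whose canonical decomposition $\mathfrak g=\bigoplus_\lambda\mathfrak g^\lambda$ satisfies $\dim\mathfrak g^\lambda\le 1$ for all $\lambda$. Let $\lambda\in\Lambda$. Then $\Gamma_r$ cannot contain exactly one path of the type $\mu\to\mu-2\lambda\to\mu-\lambda\to\mu$; that is, the number of $\mu\in\Lambda$ such that $\mu-2\lambda,\mu-\lambda\in\Lambda$ and $\Gamma_r$ contains the edges from $\mu$ to $\mu-2\lambda$, from $\mu-2\lambda$ to $\mu-\lambda$, and from $\mu-\lambda$ to $\mu$, is not equal to $1$.
   Context: All algebras are finite dimensional. A left-symmetric algebra is a vector space $\mathfrak g$ with a bilinear product such that $x(yz)-(xy)z=y(xz)-(yx)z$ for all $x,y,z$. Then $[x,y]=xy-yx$ is a Lie bracket and $L(x)y=xy$ defines a representation of the Lie algebra $\mathfrak g$. The fields $F_x(y)=xy+x$, $x\in\mathfrak g$, form a Lie algebra of affine vector fields on the space $\mathfrak g$; $\mathfrak g$ is complete if the group of affine transformations generated by their flows acts transitively on $\mathfrak g$. Canonical decomposition: a complete left-symmetric algebra over $\mathbb C$ has a unique Cartan subalgebra $\mathfrak h$ of the Lie algebra $\mathfrak g$ such that, for every linear functional $\lambda$ on $\mathfrak h$, the root subspace (generalized weight space) $\mathfrak g^\lambda$ of $\lambda$ for $L|_{\mathfrak h}$ equals the root subspace for $\operatorname{ad}|_{\mathfrak h}$; the canonical decomposition is $\mathfrak g=\bigoplus_\lambda\mathfrak g^\lambda$,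 and $\mathfrak g^0=\mathfrak h$. It satisfies $\mathfrak g^\lambda\mathfrak g^\mu\subseteq\mathfrak g^{\lambda+\mu}$. Graphs: assume $\dim\mathfrak g^\lambda\le1$ for all $\lambda$. Fix $e_0\in\mathfrak g^0$, $e_0\neq0$. Identify each functional $\lambda$ with $\mathfrak g^\lambda\ne0$ with the number $\lambda(e_0)$; the set of these numbers is $\Lambda\subset\mathbb C$, the spectrum of $L(e_0)$ (it contains $0$). For each $\lambda\in\Lambda$ choose an eigenvector $e_\lambda\in\mathfrak g^\lambda$, $e_0e_\lambda=\lambda e_\lambda$ (with the chosen $e_0$ for $\lambda=0$). In the base $\{e_\lambda\}_{\lambda\in\Lambda}$ the product is $e_\lambda e_\mu=c_{\lambda,\mu}e_{\lambda+\mu}$, with the convention $e_\lambda=0$ and $c_{\lambda,\mu}=c_{\mu,\lambda}=0$ if $\lambda\notin\Lambda$. $\Gamma_r$ is the directed graph with vertex set $\Lambda$ having an edge from $\lambda$ to $\mu$ if and only if $c_{\lambda,\mu-\lambda}\neq0$. *)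

theory Defs
  imports
    Complex_Main
    "HOL-Algebra.Bij"
    "HOL-Algebra.Generated_Groups"
    "Graph_Theory.Pair_Digraph"
begin

locale left_symmetric_algebra = vector_space scale
  for scale :: "complex \<Rightarrow> 'a::ab_group_add \<Rightarrow> 'a" +
  fixes mul :: "'a \<Rightarrow> 'a \<Rightarrow> 'a" (infixl "\<cdot>" 70)
  assumes finite_dimensional: "\<exists>B. finite B \<and> span B = UNIV"
    and linear_right: "\<And>x. Vector_Spaces.linear scale scale (\<lambda>y. x \<cdot> y)"
    and linear_left: "\<And>y. Vector_Spaces.linear scale scale (\<lambda>x. x \<cdot> y)"
    and left_symmetric:
      "\<And>x y z. x \<cdot> (y \<cdot> z) - (x \<cdot> y) \<cdot> z = y \<cdot> (x \<cdot> z) - (y \<cdot> x) \<cdot> z"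
begin

definition bracket :: "'a \<Rightarrow> 'a \<Rightarrow> 'a" where
  "bracket x y = x \<cdot> y - y \<cdot> x"

definition affine_field :: "'a \<Rightarrow> 'a \<Rightarrow> 'a" where
  "affine_field x y = x \<cdot> y + x"

(* The vector space carries no chosen norm.  Its canonical topology is the coarsest one making
   all linear functionals continuous, so a curve is differentiable with derivative v iff its
   composition with each linear functional f is, with derivative f v. *)
definition is_flow :: "('a \<Rightarrow> 'a) \<Rightarrow> (real \<Rightarrow> 'a \<Rightarrow> 'a) \<Rightarrow> bool" where
  "is_flow F \<Phi> \<longleftrightarrow>
     (\<forall>y. \<Phi> 0 y = y) \<and>
     (\<forall>f y t. Vector_Spaces.linear scale (*) f \<longrightarrow>
        ((\<lambda>s. f (\<Phi> s y)) has_vector_derivative f (F (\<Phi> t y))) (at t))"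

(* Real time suffices: the flow of F_x at complex time c is the flow of F_{cx} at time 1. *)
definition affine_group :: "('a \<Rightarrow> 'a) set" where
  "affine_group = generate (BijGroup UNIV) {\<Phi> t |\<Phi> x t. is_flow (affine_field x) \<Phi>}"

definition complete_lsa :: bool where
  "complete_lsa \<longleftrightarrow> (\<forall>y z. \<exists>g\<in>affine_group. g y = z)"

definition lie_subalgebra :: "'a set \<Rightarrow> bool" where
  "lie_subalgebra H \<longleftrightarrow> subspace H \<and> (\<forall>x\<in>H. \<forall>y\<in>H. bracket x y \<in> H)"

primrec lower_central :: "'a set \<Rightarrow> nat \<Rightarrow> 'a set" where
  "lower_central H 0 = H"
| "lower_central H (Suc n) = span {bracket x y |x y. x \<in> H \<and> y \<in> lower_central H n}"

definition cartan_subalgebra :: "'a set \<Rightarrow> bool" where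
  "cartan_subalgebra H \<longleftrightarrow>
     lie_subalgebra H \<and> (\<exists>n. lower_central H n = {0}) \<and> {x. \<forall>y\<in>H. bracket x y \<in> H} = H"

(* A functional on H is a total function whose values outside H are arbitrary and never used. *)
definition functional_on :: "'a set \<Rightarrow> ('a \<Rightarrow> complex) \<Rightarrow> bool" where
  "functional_on H \<phi> \<longleftrightarrow>
     (\<forall>x\<in>H. \<forall>y\<in>H. \<phi> (x + y) = \<phi> x + \<phi> y) \<and> (\<forall>a. \<forall>x\<in>H. \<phi> (scale a x) = a * \<phi> x)"

(* The action \<rho> is mul for L restricted to H and bracket for ad restricted to H. *)
definition root_subspace ::
    "('a \<Rightarrow> 'a \<Rightarrow> 'a) \<Rightarrow> 'a set \<Rightarrow> ('a \<Rightarrow> complex) \<Rightarrow> 'a set" where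
  "root_subspace \<rho> H \<phi> =
     {v. \<forall>x\<in>H. \<exists>n. ((\<lambda>w. \<rho> x w - scale (\<phi> x) w) ^^ n) v = 0}"

definition canonical_cartan :: "'a set \<Rightarrow> bool" where
  "canonical_cartan H \<longleftrightarrow>
     cartan_subalgebra H \<and>
     (\<forall>\<phi>. functional_on H \<phi> \<longrightarrow> root_subspace mul H \<phi> = root_subspace bracket H \<phi>)"

definition is_root :: "'a set \<Rightarrow> ('a \<Rightarrow> complex) \<Rightarrow> bool" where
  "is_root H \<phi> \<longleftrightarrow> functional_on H \<phi> \<and> root_subspace mul H \<phi> \<noteq> {0}"

definition Spec :: "'a set \<Rightarrow> 'a \<Rightarrow> complex set" where
  "Spec H e\<^sub>0 = {\<phi> e\<^sub>0 |\<phi>. is_root H \<phi>}"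

definition root_base :: "'a set \<Rightarrow> 'a \<Rightarrow> (complex \<Rightarrow> 'a) \<Rightarrow> bool" where
  "root_base H e\<^sub>0 e \<longleftrightarrow>
     e 0 = e\<^sub>0 \<and>
     (\<forall>\<phi>. is_root H \<phi> \<longrightarrow>
        e (\<phi> e\<^sub>0) \<in> root_subspace mul H \<phi> \<and> e (\<phi> e\<^sub>0) \<noteq> 0 \<and>
        e\<^sub>0 \<cdot> e (\<phi> e\<^sub>0) = scale (\<phi> e\<^sub>0) (e (\<phi> e\<^sub>0))) \<and>
     (\<forall>\<alpha>. \<alpha> \<notin> Spec H e\<^sub>0 \<longrightarrow> e \<alpha> = 0)"

(* If \<alpha>, \<mu> lie in S but \<alpha> + \<mu> does not, then e (\<alpha> + \<mu>) = 0 and c \<alpha> \<mu> is unconstrained;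
   such values never enter Gamma_r. *)
definition structure_constants ::
    "complex set \<Rightarrow> (complex \<Rightarrow> 'a) \<Rightarrow> (complex \<Rightarrow> complex \<Rightarrow> complex) \<Rightarrow> bool" where
  "structure_constants S e c \<longleftrightarrow>
     (\<forall>\<alpha> \<mu>. e \<alpha> \<cdot> e \<mu> = scale (c \<alpha> \<mu>) (e (\<alpha> + \<mu>))) \<and>
     (\<forall>\<alpha> \<mu>. \<alpha> \<notin> S \<or> \<mu> \<notin> S \<longrightarrow> c \<alpha> \<mu> = 0)"

end

definition Gamma_r ::
    "complex set \<Rightarrow> (complex \<Rightarrow> complex \<Rightarrow> complex) \<Rightarrow> complex pair_pre_digraph" where
  "Gamma_r S c =
     \<lparr>pverts = S, parcs = {(\<alpha>, \<mu>). \<alpha> \<in> S \<and> \<mu> \<in> S \<and> c \<alpha> (\<mu> - \<alpha>) \<noteq> 0}\<rparr>"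

end

theory Submission
  imports Defs "Jordan_Normal_Form.Schur_Decomposition"
begin

text \<open>
  Write \<open>R\<^sub>x\<close> for right multiplication \<open>v \<mapsto> v \<cdot> x\<close>.  A path
  \<open>\<mu> \<rightarrow> \<mu> - 2\<alpha> \<rightarrow> \<mu> - \<alpha> \<rightarrow> \<mu>\<close> of \<open>\<Gamma>\<^sub>r\<close> is a nonzero diagonal entry, at position \<open>\<mu>\<close>,
  of the matrix of \<open>R\<^sub>x R\<^sub>x R\<^sub>y\<close> in the base \<open>(e\<^sub>\<lambda>)\<close>, where \<open>x = e\<^sub>\<alpha>\<close> and \<open>y = e\<^bsub>-2\<alpha>\<^esub>\<close>.  A single
  nonzero diagonal entry would make the trace nonzero, so it suffices that \<open>tr (R\<^sub>x R\<^sub>x R\<^sub>y) = 0\<close>.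

  In a complete left-symmetric algebra every \<open>R\<^sub>z\<close> is nilpotent, so \<open>tr (R\<^sub>z R\<^sub>z R\<^sub>z) = 0\<close> for all \<open>z\<close>;
  taking \<open>z = a x + y\<close> and comparing coefficients of \<open>a\<^sup>2\<close> gives the mixed identity
  (\<open>trace_cube_eq_0\<close>, \<open>trace_mixed_cube_eq_0\<close>).

  Nilpotency comes from transitivity.  The values at \<open>z\<close> of the affine fields fill the image of
  \<open>I + R\<^sub>z\<close>.  The flow \<open>\<Phi>\<close> of an affine field \<open>F\<^sub>y\<close> carries affine fields to affine fields: with
  \<open>M = I + R\<^bsub>\<Phi> t z\<^esub>\<close>, left symmetry turns the flow equation into
  \<open>M' = L\<^sub>y M - M ad y\<close>.  Hence surjectivity of \<open>I + R\<^sub>z\<close> is preserved along flows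
  (\<open>surj_affine_field_flow\<close>).  It holds at \<open>z = 0\<close>, so by transitivity it holds everywhere, and in finite
  dimension \<open>I + R\<^sub>z\<close> is then injective for all \<open>z\<close>.  Replacing \<open>z\<close> by its complex multiples
  excludes every nonzero eigenvalue of \<open>R\<^sub>z\<close> (\<open>complete_right_mul_eigenvalue\<close>).

  The trace is taken on the span of the \<open>e\<^sub>\<lambda>\<close>: these are eigenvectors of \<open>L(e\<^sub>0)\<close> with distinct
  eigenvalues, hence independent and finite in number, and their span is closed under the product.
\<close>

section \<open>Traces of cubes of nilpotent matrices\<close>

lemma strictly_upper_triangular_cube_diag:
  fixes B :: "complex mat"
  assumes B: "B \<in> carrier_mat n n"
    and upper: "\<And>i j. i < n \<Longrightarrow> j < n \<Longrightarrow> j \<le> i \<Longrightarrow> B $$ (i, j) = 0"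
    and i: "i < n"
  shows "(B * B * B) $$ (i, i) = 0"
proof -
  have "(B * B * B) $$ (i, i) = (\<Sum>j = 0..<n. B $$ (i, j) * (\<Sum>k = 0..<n. B $$ (j, k) * B $$ (k, i)))"
    using B i by (simp add: scalar_prod_def)
  also have "\<dots> = (\<Sum>j = 0..<n. \<Sum>k = 0..<n. B $$ (i, j) * B $$ (j, k) * B $$ (k, i))"
    by (simp add: sum_distrib_left mult.assoc)
  also have "\<dots> = 0"
  proof (intro sum.neutral ballI)
    fix k j assume "k \<in> {0..<n}" "j \<in> {0..<n}"
    then have "B $$ (i, j) = 0 \<or> B $$ (j, k) = 0 \<or> B $$ (k, i) = 0"
      using upper[of i j] upper[of j k] upper[of k i] i by fastforce
    then show "B $$ (i, j) * B $$ (j, k) * B $$ (k, i) = 0" by auto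
  qed
  finally show ?thesis .
qed

lemma diag_sum_mult_commute:
  fixes X Y :: "complex mat"
  assumes X: "X \<in> carrier_mat n n" and Y: "Y \<in> carrier_mat n n"
  shows "(\<Sum>i<n. (X * Y) $$ (i, i)) = (\<Sum>i<n. (Y * X) $$ (i, i))"
proof -
  have "(\<Sum>i<n. (X * Y) $$ (i, i)) = (\<Sum>i<n. \<Sum>j<n. X $$ (i, j) * Y $$ (j, i))"
    using X Y by (simp add: scalar_prod_def atLeast0LessThan)
  also have "\<dots> = (\<Sum>j<n. \<Sum>i<n. Y $$ (j, i) * X $$ (i, j))"
    by (subst sum.swap) (simp add: mult.commute)
  also have "\<dots> = (\<Sum>i<n. (Y * X) $$ (i, i))"
    using X Y by (simp add: scalar_prod_def atLeast0LessThan)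
  finally show ?thesis .
qed

text \<open>By Schur's theorem the matrix is similar to a triangular one, whose diagonal consists of
  eigenvalues and therefore vanishes.\<close>
lemma trace_cube_mat_eq_0:
  fixes A :: "complex mat"
  assumes A: "A \<in> carrier_mat n n"
    and eig: "\<And>k. eigenvalue A k \<Longrightarrow> k = 0"
  shows "(\<Sum>i<n. (A * A * A) $$ (i, i)) = 0"
proof -
  obtain es where es: "char_poly A = (\<Prod>a\<leftarrow>es. [:- a, 1:])"
    using char_poly_factorized[OF A] by blast
  obtain B where B: "B \<in> carrier_mat n n" "upper_triangular B" "similar_mat A B"
    using schur_upper_triangular[OF A es] by blast
  obtain P Q where wit: "similar_mat_wit A B P Q"
    using B(3) unfolding similar_mat_def by blast
  have PQ: "P \<in> carrier_mat n n" "Q \<in> carrier_mat n n" "Q * P = 1\<^sub>m n"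
    using similar_mat_witD2[OF A wit] by simp_all
  have diag: "B $$ (i, i) = 0" if i: "i < n" for i
  proof (rule eig)
    have "B $$ (i, i) \<in> set (diag_mat B)" using B(1) i by (auto simp: diag_mat_def)
    then have "poly (char_poly B) (B $$ (i, i)) = 0"
      unfolding char_poly_upper_triangular[OF B(1,2)] poly_prod_list
      by (auto intro!: image_eqI)
    then show "eigenvalue A (B $$ (i, i))"
      unfolding eigenvalue_root_char_poly[OF A] char_poly_similar[OF B(3)] .
  qed
  have upper: "B $$ (i, j) = 0" if "i < n" "j < n" "j \<le> i" for i j
    using that diag B(1) upper_triangularD[OF B(2), of j i] by (cases "j = i") auto
  have "A ^\<^sub>m 3 = P * B ^\<^sub>m 3 * Q" by (rule similar_mat_wit_pow_id[OF wit])
  then have "A * A * A = P * (B * B * B) * Q"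
    using A B(1) by (simp add: numeral_3_eq_3)
  then have "(\<Sum>i<n. (A * A * A) $$ (i, i)) = (\<Sum>i<n. (P * (B * B * B) * Q) $$ (i, i))"
    by (simp only:)
  also have "\<dots> = (\<Sum>i<n. (Q * (P * (B * B * B))) $$ (i, i))"
    using PQ(1,2) B(1) by (intro diag_sum_mult_commute) auto
  also have "Q * (P * (B * B * B)) = (Q * P) * (B * B * B)"
    by (rule assoc_mult_mat[symmetric, of _ n n _ n _ n]) (use PQ(1,2) B(1) in auto)
  also have "\<dots> = B * B * B"
    unfolding PQ(3) using B(1) by (intro left_mult_one_mat) auto
  finally show ?thesis
    using strictly_upper_triangular_cube_diag[OF B(1) upper] by simp
qed

text \<open>Matrices are indexed here by an arbitrary finite set, since the base of the algebra is
  indexed by complex numbers.\<close>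
lemma trace_cube_eq_0:
  fixes m :: "'i \<Rightarrow> 'i \<Rightarrow> complex"
  assumes I: "finite I"
    and eig: "\<And>k w i. k \<noteq> 0 \<Longrightarrow> (\<And>i. i \<in> I \<Longrightarrow> (\<Sum>j\<in>I. m i j * w j) = k * w i) \<Longrightarrow> i \<in> I \<Longrightarrow> w i = 0"
  shows "(\<Sum>i\<in>I. \<Sum>j\<in>I. \<Sum>k\<in>I. m i j * m j k * m k i) = 0"
proof -
  obtain h where h: "bij_betw h {..<card I} I"
    using ex_bij_betw_nat_finite[OF I] atLeast0LessThan by auto
  define n where "n = card I"
  note h = h[folded n_def]
  have reindex: "(\<Sum>i\<in>I. f i) = (\<Sum>i<n. f (h i))" for f :: "'i \<Rightarrow> complex"
    using sum.reindex_bij_betw[OF h, of f] by simp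
  have hI: "h i \<in> I" if "i < n" for i using h that by (auto dest: bij_betwE)
  define A where "A = mat n n (\<lambda>(i, j). m (h i) (h j))"
  have A: "A \<in> carrier_mat n n" by (simp add: A_def)
  have "k = 0" if k: "eigenvalue A k" for k
  proof (rule ccontr)
    assume k0: "k \<noteq> 0"
    obtain v where v: "v \<in> carrier_vec n" "v \<noteq> 0\<^sub>v n" "A *\<^sub>v v = k \<cdot>\<^sub>v v"
      using k A unfolding eigenvalue_def eigenvector_def by auto
    define w where "w i = v $ (inv_into {..<n} h i)" for i
    have w: "w (h i) = v $ i" if "i < n" for i
      using that h by (simp add: w_def bij_betw_inv_into_left)
    have "(\<Sum>j\<in>I. m i j * w j) = k * w i" if "i \<in> I" for i
    proof -
      obtain r where r: "r < n" "i = h r" using h \<open>i \<in> I\<close> by (auto simp: bij_betw_def)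
      have "(A *\<^sub>v v) $ r = (\<Sum>j<n. m (h r) (h j) * v $ j)"
        using r v(1) by (simp add: A_def scalar_prod_def atLeast0LessThan)
      moreover have "(A *\<^sub>v v) $ r = k * v $ r" using r v by simp
      ultimately show ?thesis using r w by (simp add: reindex)
    qed
    then have "w i = 0" if "i \<in> I" for i using eig[OF k0] that by blast
    then have "v $ i = 0" if "i < n" for i using w[OF that] hI[OF that] by simp
    then have "v = 0\<^sub>v n" using v(1) by (intro eq_vecI) auto
    with v show False by simp
  qed
  then have "(\<Sum>i<n. (A * A * A) $$ (i, i)) = 0" using A by (intro trace_cube_mat_eq_0) auto
  moreover have "(A * A * A) $$ (i, i) = (\<Sum>j<n. \<Sum>k<n. m (h i) (h j) * m (h j) (h k) * m (h k) (h i))"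
    if "i < n" for i
    using that by (simp add: A_def scalar_prod_def atLeast0LessThan sum_distrib_right) (rule sum.swap)
  ultimately show ?thesis by (simp add: reindex)
qed

text \<open>Polarisation: the trace of \<open>(a A + B)\<^sup>3\<close> is a polynomial in \<open>a\<close> that vanishes identically, and its
  coefficient of \<open>a\<^sup>2\<close> is three times the trace of \<open>A A B\<close> because traces are cyclic.\<close>
lemma trace_mixed_cube_eq_0:
  fixes A B :: "'i \<Rightarrow> 'i \<Rightarrow> complex"
  assumes I: "finite I"
    and eig: "\<And>a k w i. k \<noteq> 0 \<Longrightarrow>
      (\<And>i. i \<in> I \<Longrightarrow> (\<Sum>j\<in>I. (a * A i j + B i j) * w j) = k * w i) \<Longrightarrow> i \<in> I \<Longrightarrow> w i = 0"
  shows "(\<Sum>i\<in>I. \<Sum>j\<in>I. \<Sum>k\<in>I. A i j * A j k * B k i) = 0"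
proof -
  define T where "T X Y Z = (\<Sum>i\<in>I. \<Sum>j\<in>I. \<Sum>k\<in>I. X i j * Y j k * Z k i)"
    for X Y Z :: "'i \<Rightarrow> 'i \<Rightarrow> complex"
  have cyc: "T X Y Z = T Y Z X" for X Y Z
  proof -
    have "T X Y Z = (\<Sum>j\<in>I. \<Sum>i\<in>I. \<Sum>k\<in>I. X i j * Y j k * Z k i)"
      unfolding T_def by (rule sum.swap)
    also have "\<dots> = (\<Sum>j\<in>I. \<Sum>k\<in>I. \<Sum>i\<in>I. X i j * Y j k * Z k i)"
      by (rule sum.cong[OF refl], rule sum.swap)
    also have "\<dots> = T Y Z X"
      unfolding T_def by (intro sum.cong refl) (simp add: mult_ac)
    finally show ?thesis .
  qed
  have zero: "T (\<lambda>i j. a * A i j + B i j) (\<lambda>i j. a * A i j + B i j) (\<lambda>i j. a * A i j + B i j) = 0" for a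
    unfolding T_def using trace_cube_eq_0[OF I, of "\<lambda>i j. a * A i j + B i j"] eig by blast
  have lin1: "T (\<lambda>i j. a * X i j + X' i j) Y Z = a * T X Y Z + T X' Y Z" for a X X' Y Z
    unfolding T_def by (simp add: distrib_right sum.distrib sum_distrib_left mult.assoc)
  have lin2: "T Y (\<lambda>i j. a * X i j + X' i j) Z = a * T Y X Z + T Y X' Z" for a X X' Y Z
    using lin1[of a X X' Z Y] cyc by metis
  have lin3: "T Y Z (\<lambda>i j. a * X i j + X' i j) = a * T Y Z X + T Y Z X'" for a X X' Y Z
    using lin1[of a X X' Y Z] cyc by metis
  have expand: "a ^ 3 * T A A A + a\<^sup>2 * (T A A B + T A B A + T B A A)
      + a * (T A B B + T B A B + T B B A) + T B B B = 0" for a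
    using zero[of a] unfolding lin1 lin2 lin3
    by (simp add: algebra_simps power2_eq_square power3_eq_cube)
  have "T A A B + T A B A + T B A A = 0"
  proof -
    have "2 * (T A A B + T A B A + T B A A) = 0"
      using arg_cong2[where f = "(+)", OF expand[of 1] expand[of "-1"]] expand[of 0]
      by (simp add: algebra_simps)
    then show ?thesis by (simp del: distrib_left_numeral)
  qed
  moreover have "T A B A = T A A B" "T B A A = T A A B" using cyc by metis+
  ultimately show ?thesis by (simp add: T_def)
qed

section \<open>Uniqueness for linear systems\<close>

text \<open>Gronwall's argument in both time directions: \<open>g t * exp (- K * t)\<close> decreases and
  \<open>g t * exp (K * t)\<close> increases.\<close>
lemma nonneg_eq_0_of_linear_growth:
  fixes g g' :: "real \<Rightarrow> real"
  assumes der: "\<And>t. (g has_real_derivative g' t) (at t)"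
    and bound: "\<And>t. \<bar>g' t\<bar> \<le> K * g t" and nonneg: "\<And>t. 0 \<le> g t" and zero: "g \<tau> = 0"
  shows "g t = 0"
proof (cases "\<tau> \<le> t")
  case True
  have "g \<tau> * exp (- K * \<tau>) \<ge> g t * exp (- K * t)"
  proof (rule DERIV_nonpos_imp_nonincreasing[OF True])
    fix s
    have "((\<lambda>s. g s * exp (- K * s)) has_real_derivative (g' s - K * g s) * exp (- K * s)) (at s)"
      by (auto intro!: derivative_eq_intros der simp: algebra_simps)
    moreover have "(g' s - K * g s) * exp (- K * s) \<le> 0"
      using bound[of s] by (intro mult_nonpos_nonneg) auto
    ultimately show "\<exists>y. ((\<lambda>s. g s * exp (- K * s)) has_real_derivative y) (at s) \<and> y \<le> 0" by blast
  qed
  then have "g t * exp (- K * t) \<le> 0" by (simp add: zero)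
  then have "g t \<le> 0" by (simp add: mult_le_0_iff)
  then show ?thesis using nonneg[of t] by simp
next
  case False
  then have le: "t \<le> \<tau>" by simp
  have "g t * exp (K * t) \<le> g \<tau> * exp (K * \<tau>)"
  proof (rule DERIV_nonneg_imp_nondecreasing[OF le])
    fix s
    have "((\<lambda>s. g s * exp (K * s)) has_real_derivative (g' s + K * g s) * exp (K * s)) (at s)"
      by (auto intro!: derivative_eq_intros der simp: algebra_simps)
    moreover have "(g' s + K * g s) * exp (K * s) \<ge> 0"
      using bound[of s] by (intro mult_nonneg_nonneg) auto
    ultimately show "\<exists>y. ((\<lambda>s. g s * exp (K * s)) has_real_derivative y) (at s) \<and> 0 \<le> y" by blast
  qed
  then have "g t * exp (K * t) \<le> 0" by (simp add: zero)
  then have "g t \<le> 0" by (simp add: mult_le_0_iff)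
  then show ?thesis using nonneg[of t] by simp
qed

lemma linear_system_unique:
  fixes u :: "'i \<Rightarrow> real \<Rightarrow> complex" and a :: "'i \<Rightarrow> 'i \<Rightarrow> complex"
  assumes I: "finite I"
    and der: "\<And>i t. i \<in> I \<Longrightarrow> (u i has_vector_derivative (\<Sum>j\<in>I. a i j * u j t)) (at t)"
    and zero: "\<And>i. i \<in> I \<Longrightarrow> u i \<tau> = 0"
    and i: "i \<in> I"
  shows "u i t = 0"
proof -
  define u' where "u' i t = (\<Sum>j\<in>I. a i j * u j t)" for i t
  define g where "g t = (\<Sum>i\<in>I. (cmod (u i t))\<^sup>2)" for t
  define g' where "g' t = (\<Sum>i\<in>I. 2 * Re (cnj (u i t) * u' i t))" for t
  define C where "C = (\<Sum>i\<in>I. \<Sum>j\<in>I. cmod (a i j))"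
  \<comment> \<open>The sum of the moduli serves as a common bound of the coefficients without a separate case for an
    empty index set.\<close>
  have C: "cmod (a i j) \<le> C" if "i \<in> I" "j \<in> I" for i j
  proof -
    have "cmod (a i j) \<le> (\<Sum>j\<in>I. cmod (a i j))" using that I by (intro member_le_sum) auto
    also have "\<dots> \<le> C" unfolding C_def
      using that I by (intro member_le_sum[of i I "\<lambda>i. \<Sum>j\<in>I. cmod (a i j)"]) (auto intro: sum_nonneg)
    finally show ?thesis .
  qed
  have C0: "C \<ge> 0" unfolding C_def by (intro sum_nonneg) auto
  have "((\<lambda>t. (cmod (u i t))\<^sup>2) has_real_derivative 2 * Re (cnj (u i t) * u' i t)) (at t)" if i: "i \<in> I" for i t
  proof -
    have R: "((\<lambda>t. Re (u i t)) has_real_derivative Re (u' i t)) (at t)"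
      using bounded_linear.has_vector_derivative[OF bounded_linear_Re der[OF i]]
      by (simp add: has_real_derivative_iff_has_vector_derivative u'_def)
    have J: "((\<lambda>t. Im (u i t)) has_real_derivative Im (u' i t)) (at t)"
      using bounded_linear.has_vector_derivative[OF bounded_linear_Im der[OF i]]
      by (simp add: has_real_derivative_iff_has_vector_derivative u'_def)
    show ?thesis unfolding cmod_power2
      by (rule derivative_eq_intros R J refl | simp)+
  qed
  then have g_der: "(g has_real_derivative g' t) (at t)" for t
    unfolding g_def g'_def by (intro DERIV_sum) auto
  have bound: "\<bar>g' t\<bar> \<le> (2 * C * card I) * g t" for t
  proof -
    have "\<bar>g' t\<bar> \<le> (\<Sum>i\<in>I. 2 * (cmod (u i t) * cmod (u' i t)))"
      unfolding g'_def
    proof (rule order_trans[OF sum_abs], rule sum_mono)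
      fix i show "\<bar>2 * Re (cnj (u i t) * u' i t)\<bar> \<le> 2 * (cmod (u i t) * cmod (u' i t))"
        using abs_Re_le_cmod[of "cnj (u i t) * u' i t"] by (simp add: norm_mult abs_mult)
    qed
    also have "\<dots> \<le> (\<Sum>i\<in>I. \<Sum>j\<in>I. C * ((cmod (u i t))\<^sup>2 + (cmod (u j t))\<^sup>2))"
    proof (rule sum_mono)
      fix i assume i: "i \<in> I"
      have "cmod (u' i t) \<le> (\<Sum>j\<in>I. C * cmod (u j t))" unfolding u'_def
        using C[OF i] by (intro order_trans[OF norm_sum] sum_mono) (auto simp: norm_mult intro: mult_right_mono)
      then have "2 * (cmod (u i t) * cmod (u' i t)) \<le> 2 * (cmod (u i t) * (\<Sum>j\<in>I. C * cmod (u j t)))"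
        by (simp add: mult_left_mono)
      also have "\<dots> = (\<Sum>j\<in>I. C * (2 * cmod (u i t) * cmod (u j t)))"
        by (simp add: sum_distrib_left algebra_simps)
      also have "\<dots> \<le> (\<Sum>j\<in>I. C * ((cmod (u i t))\<^sup>2 + (cmod (u j t))\<^sup>2))"
        using C0 by (intro sum_mono mult_left_mono sum_squares_bound) auto
      finally show "2 * (cmod (u i t) * cmod (u' i t)) \<le> \<dots>" .
    qed
    also have "\<dots> = (2 * C * card I) * g t"
      by (simp add: g_def sum.distrib sum_distrib_left[symmetric] sum_distrib_right algebra_simps)
    finally show ?thesis .
  qed
  have "g t = 0"
    by (rule nonneg_eq_0_of_linear_growth[of g g' _ \<tau>, OF g_der bound]) (auto simp: g_def zero intro: sum_nonneg)
  then show ?thesis unfolding g_def using I i by (subst (asm) sum_nonneg_eq_0_iff) auto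
qed

section \<open>Curves in a left-symmetric algebra\<close>

lemma has_vector_derivative_affine_time:
  fixes h :: "real \<Rightarrow> 'v::real_normed_vector"
  assumes "(h has_vector_derivative h') (at (r * s + t))"
  shows "((\<lambda>s. h (r * s + t)) has_vector_derivative r *\<^sub>R h') (at s)"
proof -
  have "((\<lambda>s. r * s + t) has_derivative (\<lambda>x. r * x)) (at s)"
    by (auto intro!: derivative_eq_intros)
  from has_derivative_compose[OF this assms[unfolded has_vector_derivative_def]]
  show ?thesis by (simp add: has_vector_derivative_def mult.commute)
qed

context left_symmetric_algebra
begin

lemma finite_basis: obtains B where "finite B" "independent B" "span B = UNIV"
proof -
  obtain B0 where B0: "finite B0" "span B0 = UNIV" using finite_dimensional by blast
  obtain B where B: "B \<subseteq> B0" "independent B" "B0 \<subseteq> span B"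
    using maximal_independent_subset by metis
  show thesis
  proof
    show "finite B" using B(1) B0(1) by (rule finite_subset)
    show "independent B" by (rule B(2))
    show "span B = UNIV" using span_mono[OF B(3)] B0(2) by (simp add: span_span top.extremum_unique)
  qed
qed

abbreviation functional :: "('a \<Rightarrow> complex) \<Rightarrow> bool" where
  "functional f \<equiv> Vector_Spaces.linear scale (*) f"

abbreviation operator :: "('a \<Rightarrow> 'a) \<Rightarrow> bool" where
  "operator A \<equiv> Vector_Spaces.linear scale scale A"

lemma functionalI:
  assumes "\<And>x y. f (x + y) = f x + f y" "\<And>r x. f (scale r x) = r * f x"
  shows "functional f"
proof (rule linear_module_homI[OF module_hom.intro])
  show "Modules.module ((*) :: complex \<Rightarrow> complex \<Rightarrow> complex)"
    by (simp add: Modules.module_def distrib_left distrib_right)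
qed (simp_all add: module_hom_axioms_def assms module_axioms)

lemma operatorI:
  assumes "\<And>x y. A (x + y) = A x + A y" "\<And>r x. A (scale r x) = scale r (A x)"
  shows "operator A"
  by (rule linear_module_homI[OF module_hom.intro[OF module_axioms module_axioms]])
    (simp add: module_hom_axioms_def assms)

text \<open>To be instantiated with a linearity fact before use: the left-hand sides apply an unknown
  function, so they match almost every term.\<close>
lemmas linear_simps =
  module_hom.add[OF module_hom_linearI] module_hom.scale[OF module_hom_linearI]
  module_hom.diff[OF module_hom_linearI] module_hom.sum[OF module_hom_linearI]
  module_hom.zero[OF module_hom_linearI]

lemma mul_simps:
  "(a + b) \<cdot> d = a \<cdot> d + b \<cdot> d" "d \<cdot> (a + b) = d \<cdot> a + d \<cdot> b"
  "(a - b) \<cdot> d = a \<cdot> d - b \<cdot> d" "d \<cdot> (a - b) = d \<cdot> a - d \<cdot> b"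
  "scale r a \<cdot> d = scale r (a \<cdot> d)" "d \<cdot> scale r a = scale r (d \<cdot> a)"
  "0 \<cdot> d = 0" "d \<cdot> 0 = 0"
  "sum f I \<cdot> d = (\<Sum>i\<in>I. f i \<cdot> d)" 
  by (simp_all add: linear_simps[OF linear_right] linear_simps[OF linear_left])

lemma functional_compose:
  assumes f: "functional f" and A: "operator A"
  shows "functional (\<lambda>x. f (A x))"
  by (rule functionalI) (simp_all only: linear_simps[OF A] linear_simps[OF f])

text \<open>Differentiability of a curve is tested against linear functionals, as for flows; no norm on the
  space is involved.\<close>
definition has_velocity :: "(real \<Rightarrow> 'a) \<Rightarrow> 'a \<Rightarrow> real \<Rightarrow> bool" where
  "has_velocity u v t \<longleftrightarrow>
     (\<forall>f. functional f \<longrightarrow> ((\<lambda>s. f (u s)) has_vector_derivative f v) (at t))"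

lemma has_velocity_add:
  assumes "has_velocity u v t" "has_velocity u' v' t"
  shows "has_velocity (\<lambda>s. u s + u' s) (v + v') t"
  unfolding has_velocity_def
proof (intro allI impI)
  fix f assume f: "functional f"
  then show "((\<lambda>s. f (u s + u' s)) has_vector_derivative f (v + v')) (at t)"
    using assms unfolding has_velocity_def linear_simps(1)[OF f]
    by (intro has_vector_derivative_add) auto
qed

lemma has_velocity_diff:
  assumes "has_velocity u v t" "has_velocity u' v' t"
  shows "has_velocity (\<lambda>s. u s - u' s) (v - v') t"
  unfolding has_velocity_def
proof (intro allI impI)
  fix f assume f: "functional f"
  then show "((\<lambda>s. f (u s - u' s)) has_vector_derivative f (v - v')) (at t)"
    using assms unfolding has_velocity_def linear_simps(3)[OF f]
    by (intro has_vector_derivative_diff) auto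
qed

lemma has_velocity_const: "has_velocity (\<lambda>s. x) 0 t"
  unfolding has_velocity_def
proof (intro allI impI)
  fix f assume f: "functional f"
  show "((\<lambda>s. f x) has_vector_derivative f 0) (at t)"
    unfolding linear_simps(5)[OF f] by (rule has_vector_derivative_const)
qed

lemma has_velocity_operator: "operator A \<Longrightarrow> has_velocity u v t \<Longrightarrow> has_velocity (\<lambda>s. A (u s)) (A v) t"
  unfolding has_velocity_def using functional_compose by blast

lemma has_velocity_shift:
  assumes "has_velocity u v (s + t)" shows "has_velocity (\<lambda>s. u (s + t)) v s"
  unfolding has_velocity_def
proof (intro allI impI)
  fix f assume "functional f"
  then show "((\<lambda>s. f (u (s + t))) has_vector_derivative f v) (at s)"
    using assms has_vector_derivative_affine_time[of "\<lambda>s. f (u s)" "f v" 1 s t]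
    by (simp add: has_velocity_def)
qed

lemma functional_expand:
  assumes f: "functional f" and B: "finite B" "independent B" "span B = UNIV"
  shows "f x = (\<Sum>b\<in>B. representation B x b * f b)"
proof -
  have "f x = f (\<Sum>b\<in>B. scale (representation B x b) b)"
    using B by (subst sum_representation_eq) auto
  then show ?thesis by (simp add: linear_simps[OF f])
qed

lemma linear_ode_unique:
  assumes A: "operator A" and der: "\<And>t. has_velocity u (A (u t)) t" and zero: "u \<tau> = 0"
  shows "u t = 0"
proof -
  obtain B where B: "finite B" "independent B" "span B = UNIV" by (rule finite_basis)
  have rep: "functional (\<lambda>v. representation B v b)" for b using linear_representation B by blast
  have "representation B (u t) b = 0" if "b \<in> B" for b
  proof (rule linear_system_unique[of B "\<lambda>b s. representation B (u s) b" "\<lambda>b b'. representation B (A b') b" \<tau>])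
    fix b s
    have "((\<lambda>s. representation B (u s) b) has_vector_derivative representation B (A (u s)) b) (at s)"
      using der rep unfolding has_velocity_def by blast
    also have "representation B (A (u s)) b = (\<Sum>b'\<in>B. representation B (A b') b * representation B (u s) b')"
      using functional_expand[of "\<lambda>x. representation B (A x) b" B "u s", OF functional_compose[OF rep A] B]
      by (simp add: mult.commute)
    finally show "((\<lambda>s. representation B (u s) b) has_vector_derivative \<dots>) (at s)" .
  qed (use B zero that in \<open>auto simp: representation_zero\<close>)
  then have "(\<Sum>b\<in>B. scale (representation B (u t) b) b) = 0" by simp
  then show ?thesis using B by (subst (asm) sum_representation_eq) auto
qed

text \<open>The transposed equation \<open>q' = q \<circ> A\<close>.  On a basis it is again a finite linear system.\<close>
lemma dual_linear_ode_unique: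
  assumes A: "operator A" and q: "\<And>t. functional (q t)"
    and der: "\<And>x t. ((\<lambda>t. q t x) has_vector_derivative q t (A x)) (at t)"
    and zero: "\<And>x. q \<tau> x = 0"
  shows "q t x = 0"
proof -
  obtain B where B: "finite B" "independent B" "span B = UNIV" by (rule finite_basis)
  have "q t b = 0" if "b \<in> B" for b
  proof (rule linear_system_unique[of B "\<lambda>b s. q s b" "\<lambda>b b'. representation B (A b) b'" \<tau>])
    fix b s
    show "((\<lambda>s. q s b) has_vector_derivative (\<Sum>b'\<in>B. representation B (A b) b' * q s b')) (at s)"
      using der[of b s] functional_expand[OF q B, of s "A b"] by simp
  qed (use B zero that in auto)
  then show ?thesis using functional_expand[OF q B, of t x] by simp
qed

text \<open>The product rule for the pairing of a moving functional with a moving vector.\<close>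
lemma has_derivative_moving_functional:
  assumes p: "\<And>s. functional (p s)" and p': "functional p'"
    and dp: "\<And>x. ((\<lambda>s. p s x) has_vector_derivative p' x) (at t)"
    and du: "has_velocity u v t"
  shows "((\<lambda>s. p s (u s)) has_vector_derivative p' (u t) + p t v) (at t)"
proof -
  obtain B where B: "finite B" "independent B" "span B = UNIV" by (rule finite_basis)
  have rep: "functional (\<lambda>v. representation B v b)" for b using linear_representation B by blast
  have "((\<lambda>s. \<Sum>b\<in>B. representation B (u s) b * p s b) has_vector_derivative
     (\<Sum>b\<in>B. representation B (u t) b * p' b + representation B v b * p t b)) (at t)"
    using du rep dp unfolding has_velocity_def
    by (intro has_vector_derivative_sum has_vector_derivative_mult) auto
  then show ?thesis
    by (simp add: sum.distrib functional_expand[OF p B, symmetric] functional_expand[OF p' B, symmetric])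
qed

section \<open>Flows of affine fields\<close>

lemma functional_vanishing_on_range:
  assumes A: "operator A" and nsurj: "\<not> surj A"
  obtains p d where "functional p" "p d \<noteq> 0" "\<And>x. p (A x) = 0"
proof -
  obtain C where C: "C \<subseteq> range A" "independent C" "range A \<subseteq> span C"
    using maximal_independent_subset by blast
  obtain D where D: "C \<subseteq> D" "independent D" "UNIV \<subseteq> span D"
    using maximal_independent_subset_extend[OF subset_UNIV C(2)] by metis
  have "subspace (range A)"
    by (rule module_hom.subspace_image[OF module_hom_linearI[OF A] subspace_UNIV])
  then have "span C \<subseteq> range A" using C(1) by (rule span_minimal[rotated])
  with nsurj have "\<not> UNIV \<subseteq> span C" by auto
  then obtain d where d: "d \<in> D" "d \<notin> C"
    using D span_mono[of D C] by blast
  show thesis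
  proof
    show "functional (\<lambda>x. representation D x d)" using linear_representation D by blast
    show "representation D d d \<noteq> 0" using representation_basis D(2) d(1) by simp
    show "representation D (A x) d = 0" for x
    proof -
      have "representation D (A x) = representation C (A x)"
        using C(3) D by (intro representation_extend) auto
      then show ?thesis using d(2) representation_ne_zero[of C "A x" d] by auto
    qed
  qed
qed

lemma operator_affine_field: "operator (\<lambda>v. affine_field v z)"
  by (rule operatorI) (simp_all add: affine_field_def mul_simps scale_right_distrib)

context
  fixes y \<Phi> assumes flow: "is_flow (affine_field y) \<Phi>"
begin

lemma flow_0: "\<Phi> 0 z = z"
  using flow by (simp add: is_flow_def)

lemma flow_velocity: "has_velocity (\<lambda>s. \<Phi> s z) (y \<cdot> \<Phi> t z + y) t"
  using flow by (simp add: is_flow_def has_velocity_def affine_field_def)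

text \<open>Both sides solve the same equation in \<open>s\<close>, so their difference solves the linear equation
  \<open>u' = y \<cdot> u\<close> and vanishes at \<open>s = 0\<close>.  The linear part of the flow is treated in the same way.\<close>
lemma flow_add: "\<Phi> (s + t) z = \<Phi> s (\<Phi> t z)"
proof -
  have "\<Phi> (s + t) z - \<Phi> s (\<Phi> t z) = 0"
  proof (rule linear_ode_unique[where u = "\<lambda>s. \<Phi> (s + t) z - \<Phi> s (\<Phi> t z)" and \<tau> = 0, OF linear_right])
    show "has_velocity (\<lambda>s. \<Phi> (s + t) z - \<Phi> s (\<Phi> t z)) (y \<cdot> (\<Phi> (s + t) z - \<Phi> s (\<Phi> t z))) s" for s
      using has_velocity_diff[OF has_velocity_shift[OF flow_velocity] flow_velocity]
      by (simp add: mul_simps)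
    show "\<Phi> (0 + t) z - \<Phi> 0 (\<Phi> t z) = 0" by (simp add: flow_0)
  qed
  then show ?thesis by simp
qed

lemma flow_minus: "\<Phi> (- t) (\<Phi> t z) = z" "\<Phi> t (\<Phi> (- t) z) = z"
  using flow_add[of "- t" t z] flow_add[of t "- t" z] by (simp_all add: flow_0)

lemma bij_flow: "bij (\<Phi> t)"
  using flow_minus by (intro o_bij[of "\<Phi> (- t)"]) auto

lemma inv_flow: "inv_into UNIV (\<Phi> t) = \<Phi> (- t)"
  using flow_minus by (intro inv_equality)

text \<open>This is \<open>exp (t L\<^sub>y)\<close>, obtained from the given flow, so that no exponential series is needed.\<close>
definition linear_part :: "real \<Rightarrow> 'a \<Rightarrow> 'a" where
  "linear_part t x = \<Phi> t x - \<Phi> t 0"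

lemma linear_part_0: "linear_part 0 x = x"
  by (simp add: linear_part_def flow_0)

lemma linear_part_velocity: "has_velocity (\<lambda>s. linear_part s x) (y \<cdot> linear_part t x) t"
  using has_velocity_diff[OF flow_velocity[of x t] flow_velocity[of 0 t]]
  by (simp add: linear_part_def mul_simps)

lemma operator_linear_part: "operator (linear_part t)"
proof (rule operatorI)
  fix a b
  have "linear_part t (a + b) - (linear_part t a + linear_part t b) = 0"
  proof (rule linear_ode_unique[where u = "\<lambda>s. linear_part s (a + b) - (linear_part s a + linear_part s b)" and \<tau> = 0, OF linear_right])
    show "has_velocity (\<lambda>s. linear_part s (a + b) - (linear_part s a + linear_part s b))
      (y \<cdot> (linear_part s (a + b) - (linear_part s a + linear_part s b))) s" for s
      unfolding mul_simps by (intro has_velocity_diff has_velocity_add linear_part_velocity)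
  qed (simp add: linear_part_0)
  then show "linear_part t (a + b) = linear_part t a + linear_part t b" by simp
next
  fix r a
  have "linear_part t (scale r a) - scale r (linear_part t a) = 0"
  proof (rule linear_ode_unique[where u = "\<lambda>s. linear_part s (scale r a) - scale r (linear_part s a)" and \<tau> = 0, OF linear_right])
    show "has_velocity (\<lambda>s. linear_part s (scale r a) - scale r (linear_part s a))
      (y \<cdot> (linear_part s (scale r a) - scale r (linear_part s a))) s" for s
      unfolding mul_simps
      by (intro has_velocity_diff has_velocity_operator[OF linear_scale_self] linear_part_velocity)
  qed (simp add: linear_part_0)
  then show "linear_part t (scale r a) = scale r (linear_part t a)" by simp
qed

lemma linear_part_mul: "linear_part t (y \<cdot> x) = y \<cdot> linear_part t x"
proof -
  have "linear_part t (y \<cdot> x) - y \<cdot> linear_part t x = 0"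
  proof (rule linear_ode_unique[where u = "\<lambda>s. linear_part s (y \<cdot> x) - y \<cdot> linear_part s x" and \<tau> = 0, OF linear_right])
    show "has_velocity (\<lambda>s. linear_part s (y \<cdot> x) - y \<cdot> linear_part s x)
      (y \<cdot> (linear_part s (y \<cdot> x) - y \<cdot> linear_part s x)) s" for s
      unfolding mul_simps
      by (intro has_velocity_diff has_velocity_operator[OF linear_right] linear_part_velocity)
  qed (simp add: linear_part_0)
  then show ?thesis by simp
qed

lemma surj_linear_part: "surj (linear_part t)"
  unfolding surj_def
proof
  fix w
  obtain x where "\<Phi> t x = w + \<Phi> t 0" using bij_flow by (metis bij_pointE)
  then show "\<exists>x. w = linear_part t x" by (intro exI[of _ x]) (simp add: linear_part_def)
qed

text \<open>
  Let \<open>p\<close> annihilate the image of \<open>I + R\<close> at time \<open>t\<close>, transport it backwards along the linear part of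
  the flow to \<open>\<pi> s = p \<circ> exp ((t - s) L\<^sub>y)\<close>, and put \<open>q s v = \<pi> s (F\<^sub>v (\<Phi> s z))\<close>.  In the derivative of
  \<open>q\<close> the contributions of \<open>L\<^sub>y\<close> cancel by left symmetry, and what remains is
  \<open>q' = q \<circ> (v \<mapsto> [v, y])\<close>.  Thus \<open>q\<close> vanishes at time \<open>0\<close> because it does at time \<open>t\<close>, and surjectivity at
  time \<open>0\<close> forces \<open>p = 0\<close>.  Arguing with annihilators rather than kernels avoids solving the
  equation \<open>v' = [y, v]\<close>.
\<close>
lemma surj_affine_field_flow:
  assumes surj: "surj (\<lambda>v. affine_field v z)"
  shows "surj (\<lambda>v. affine_field v (\<Phi> t z))"
proof (rule ccontr)
  assume "\<not> surj (\<lambda>v. affine_field v (\<Phi> t z))"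
  then obtain p d where p: "functional p" "p d \<noteq> 0" "\<And>v. p (affine_field v (\<Phi> t z)) = 0"
    using functional_vanishing_on_range[OF operator_affine_field] by metis
  define \<pi> where "\<pi> s x = p (linear_part (t - s) x)" for s x
  have \<pi>: "functional (\<pi> s)" for s
    unfolding \<pi>_def by (rule functional_compose[OF p(1) operator_linear_part])
  have d\<pi>: "((\<lambda>s. \<pi> s x) has_vector_derivative - \<pi> s (y \<cdot> x)) (at s)" for s x
    using linear_part_velocity[of x "t - s"] p(1)
      has_vector_derivative_affine_time[of "\<lambda>s. p (linear_part s x)" "p (linear_part (t - s) (y \<cdot> x))" "-1" s t]
    by (simp add: has_velocity_def \<pi>_def linear_part_mul)
  define q where "q s v = \<pi> s (affine_field v (\<Phi> s z))" for s v
  have q: "functional (q s)" for s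
    unfolding q_def by (rule functional_compose[OF \<pi> operator_affine_field])
  have "q 0 v = 0" for v
  proof (rule dual_linear_ode_unique[where A = "\<lambda>v. bracket v y" and q = q, OF _ q])
    show "operator (\<lambda>v. bracket v y)"
      by (rule operatorI) (simp_all add: bracket_def mul_simps scale_right_diff_distrib)
    show "q t v = 0" for v by (simp add: q_def \<pi>_def linear_part_0 p(3))
    fix v s
    let ?z = "\<Phi> s z"
    have vel: "has_velocity (\<lambda>s. affine_field v (\<Phi> s z)) (v \<cdot> (y \<cdot> ?z + y)) s"
      using has_velocity_add[OF has_velocity_operator[OF linear_right flow_velocity] has_velocity_const[of v]]
      by (simp add: affine_field_def)
    have neg: "functional (\<lambda>x. - \<pi> s (y \<cdot> x))"
      by (rule functionalI) (simp_all add: linear_simps[OF \<pi>] mul_simps)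
    have "(q' has_vector_derivative - \<pi> s (y \<cdot> affine_field v ?z) + \<pi> s (v \<cdot> (y \<cdot> ?z + y))) (at s)"
      if "q' = (\<lambda>s. q s v)" for q'
      unfolding that q_def by (rule has_derivative_moving_functional[OF \<pi> neg d\<pi> vel])
    moreover have "- \<pi> s (y \<cdot> affine_field v ?z) + \<pi> s (v \<cdot> (y \<cdot> ?z + y))
        = \<pi> s (v \<cdot> (y \<cdot> ?z + y) - y \<cdot> affine_field v ?z)"
      by (simp add: linear_simps[OF \<pi>])
    moreover have "v \<cdot> (y \<cdot> ?z + y) - y \<cdot> affine_field v ?z = affine_field (bracket v y) ?z"
      using left_symmetric[of v y ?z] by (simp add: affine_field_def bracket_def mul_simps algebra_simps)
    ultimately show "((\<lambda>s. q s v) has_vector_derivative q s (bracket v y)) (at s)"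
      by (simp add: q_def)
  qed
  then have *: "p (linear_part t (affine_field v z)) = 0" for v by (simp add: q_def \<pi>_def flow_0)
  obtain x where x: "d = linear_part t x" using surj_linear_part by (metis surjD)
  obtain v where "x = affine_field v z" using surj by (metis surjD)
  then show False using * p(2) x by simp
qed

end

lemma surj_affine_field_affine_group:
  assumes "g \<in> affine_group"
  shows "bij g \<and> (\<forall>z. surj (\<lambda>v. affine_field v z) \<longrightarrow> surj (\<lambda>v. affine_field v (g z)))"
  using assms unfolding affine_group_def
proof (induction rule: generate.induct)
  case one
  have id: "\<one>\<^bsub>BijGroup UNIV\<^esub> = (id :: 'a \<Rightarrow> 'a)" by (simp add: BijGroup_def fun_eq_iff)
  show ?case unfolding id by (intro conjI bij_id) simp
next
  case (incl h)
  then show ?case using bij_flow surj_affine_field_flow by blast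
next
  case (inv h)
  then obtain \<Phi> y t where h: "h = \<Phi> t" and flow: "is_flow (affine_field y) \<Phi>" by blast
  have "inv\<^bsub>BijGroup UNIV\<^esub> h = \<Phi> (- t)"
    using bij_flow[OF flow, of t] inv_flow[OF flow, of t] h
    by (subst inv_BijGroup) (simp_all add: Bij_def restrict_UNIV)
  then show ?case using bij_flow[OF flow, of "- t"] surj_affine_field_flow[OF flow, of _ "- t"] by simp
next
  case (eng h1 h2)
  then have "h1 \<otimes>\<^bsub>BijGroup UNIV\<^esub> h2 = h1 \<circ> h2"
    by (simp add: BijGroup_def Bij_def compose_def fun_eq_iff)
  moreover have "bij (h1 \<circ> h2)" using eng.IH bij_comp by blast
  ultimately show ?case using eng.IH by (metis comp_apply)
qed

section \<open>Right multiplications of a complete algebra\<close>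

text \<open>An eigenvector \<open>v\<close> of \<open>R\<^sub>x\<close> for \<open>k \<noteq> 0\<close> lies in the kernel of \<open>I + R\<^sub>z\<close> for \<open>z = - x / k\<close>.\<close>
lemma complete_right_mul_eigenvalue:
  assumes complete: complete_lsa and eq: "v \<cdot> x = scale k v" and k: "k \<noteq> 0"
  shows "v = 0"
proof -
  define z where "z = scale (- inverse k) x"
  obtain g where g: "g \<in> affine_group" "g 0 = z" using complete unfolding complete_lsa_def by blast
  have "surj (\<lambda>v. affine_field v 0)" by (simp add: affine_field_def mul_simps)
  then have surj: "surj (\<lambda>v. affine_field v z)" using surj_affine_field_affine_group[OF g(1)] g(2) by blast
  obtain B where B: "finite B" "independent B" "span B = UNIV" by (rule finite_basis)
  interpret finite_dimensional_vector_space scale B using B by unfold_locales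
  have "inj (\<lambda>v. affine_field v z)"
    using linear_surj_imp_inj[OF operator_affine_field surj] .
  moreover have "affine_field v z = affine_field 0 z"
    using eq k by (simp add: z_def affine_field_def mul_simps del: scale_minus_left) simp
  ultimately show ?thesis by (rule injD)
qed

section \<open>The trace identity on the span of the eigenvectors\<close>

lemma eigenvectors_independent:
  assumes T: "operator T" and I: "finite I"
    and eig: "\<And>i. i \<in> I \<Longrightarrow> T (e i) = scale i (e i)" and nz: "\<And>i. i \<in> I \<Longrightarrow> e i \<noteq> 0"
    and sum0: "(\<Sum>i\<in>I. scale (w i) (e i)) = 0" and i: "i \<in> I"
  shows "w i = 0"
  using I eig nz sum0 i
proof (induction I arbitrary: w i rule: finite_induct)
  case empty
  then show ?case by simp
next
  case (insert r I)
  have "(\<Sum>j\<in>insert r I. scale (w j * j) (e j)) = T (\<Sum>j\<in>insert r I. scale (w j) (e j))"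
    unfolding linear_simps[OF T] using insert.prems(1) by (intro sum.cong) auto
  also have "\<dots> = 0" by (simp only: insert.prems(3)) (simp add: linear_simps[OF T])
  finally have "(\<Sum>j\<in>insert r I. scale (w j * j) (e j)) - scale r (\<Sum>j\<in>insert r I. scale (w j) (e j)) = 0"
    by (simp only: insert.prems(3)) simp
  then have "(\<Sum>j\<in>I. scale (w j * (j - r)) (e j)) = 0"
    using insert.hyps
    by (simp add: scale_sum_right sum_subtractf algebra_simps)
  then have "w j * (j - r) = 0" if "j \<in> I" for j
    using insert.IH[of "\<lambda>j. w j * (j - r)" j] insert.prems(1,2) that by blast
  then have wI: "w j = 0" if "j \<in> I" for j using that insert.hyps(2) by fastforce
  then have "scale (w r) (e r) = 0" using insert.prems(3) insert.hyps by simp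
  then have "w r = 0" using insert.prems(2) by simp
  with wI insert.prems(4) show ?case by blast
qed

lemma finite_eigenvalues:
  assumes T: "operator T"
    and eig: "\<And>i. i \<in> S \<Longrightarrow> T (e i) = scale i (e i)" and nz: "\<And>i. i \<in> S \<Longrightarrow> e i \<noteq> 0"
  shows "finite S"
proof -
  obtain B where B: "finite B" "independent B" "span B = UNIV" by (rule finite_basis)
  interpret finite_dimensional_vector_space scale B using B by unfold_locales
  have inj: "inj_on e S"
    by (rule inj_onI) (metis eig nz scale_right_imp_eq)
  have "independent (e ` S)"
    unfolding independent_explicit_finite_subsets
  proof (intro allI impI ballI)
    fix X u v assume X: "X \<subseteq> e ` S" "finite X" and s: "(\<Sum>v\<in>X. scale (u v) v) = 0" and v: "v \<in> X"
    obtain I where I: "I \<subseteq> S" "finite I" "X = e ` I" using X finite_subset_image by metis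
    have "(\<Sum>i\<in>I. scale (u (e i)) (e i)) = 0"
      using s I inj by (simp add: sum.reindex inj_on_subset)
    then show "u v = 0"
      using eigenvectors_independent[OF T I(2), of e "\<lambda>i. u (e i)"] eig nz I v by blast
  qed
  then have "finite (e ` S)" by (rule finiteI_independent)
  then show ?thesis using inj by (rule finite_imageD)
qed


text \<open>\<open>R \<alpha>\<close> is the matrix of right multiplication by \<open>e \<alpha>\<close>: row \<open>i\<close>, column \<open>j\<close> holds the coefficient of
  \<open>e i\<close> in \<open>e j \<cdot> e \<alpha>\<close>.\<close>
lemma mixed_trace_right_mul_eq_0:
  fixes e :: "complex \<Rightarrow> 'a" and c :: "complex \<Rightarrow> complex \<Rightarrow> complex"
  defines "R \<equiv> \<lambda>\<alpha> i j. if i = j + \<alpha> then c j \<alpha> else 0"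
  assumes complete: complete_lsa
    and T: "operator T"
    and eig: "\<And>i. i \<in> S \<Longrightarrow> T (e i) = scale i (e i)" and nz: "\<And>i. i \<in> S \<Longrightarrow> e i \<noteq> 0"
    and off: "\<And>i. i \<notin> S \<Longrightarrow> e i = 0"
    and mul: "\<And>i j. e i \<cdot> e j = scale (c i j) (e (i + j))"
  shows "(\<Sum>i\<in>S. \<Sum>j\<in>S. \<Sum>k\<in>S. R \<alpha> i j * R \<alpha> j k * R \<beta> k i) = 0"
proof (rule trace_mixed_cube_eq_0)
  show fin: "finite S" by (rule finite_eigenvalues[OF T eig nz])
  have column: "(\<Sum>i\<in>S. scale (R \<gamma> i j) (e i)) = e j \<cdot> e \<gamma>" for \<gamma> j
  proof -
    have "(\<Sum>i\<in>S. scale (R \<gamma> i j) (e i)) = (\<Sum>i\<in>S. if i = j + \<gamma> then scale (c j \<gamma>) (e (j + \<gamma>)) else 0)"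
      by (intro sum.cong) (auto simp: R_def)
    also have "\<dots> = scale (c j \<gamma>) (e (j + \<gamma>))"
      using fin off[of "j + \<gamma>"] by simp
    finally show ?thesis by (simp add: mul)
  qed
  fix a k w i
  assume k: "k \<noteq> 0" and i: "i \<in> S"
    and w: "\<And>i. i \<in> S \<Longrightarrow> (\<Sum>j\<in>S. (a * R \<alpha> i j + R \<beta> i j) * w j) = k * w i"
  define v where "v = (\<Sum>j\<in>S. scale (w j) (e j))"
  define x where "x = scale a (e \<alpha>) + e \<beta>"
  have "e j \<cdot> x = (\<Sum>i\<in>S. scale (a * R \<alpha> i j + R \<beta> i j) (e i))" for j
    unfolding x_def
    by (simp add: mul_simps column[symmetric] scale_left_distrib sum.distrib scale_sum_right)
  then have "v \<cdot> x = (\<Sum>j\<in>S. \<Sum>i\<in>S. scale ((a * R \<alpha> i j + R \<beta> i j) * w j) (e i))"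
    by (simp add: v_def mul_simps scale_sum_right mult.commute)
  also have "\<dots> = (\<Sum>i\<in>S. scale (\<Sum>j\<in>S. (a * R \<alpha> i j + R \<beta> i j) * w j) (e i))"
    by (subst sum.swap) (simp add: scale_sum_left)
  also have "\<dots> = scale k v"
    by (simp add: w v_def scale_sum_right)
  finally have "v = 0" using complete_right_mul_eigenvalue[OF complete _ k] by blast
  then show "w i = 0"
    using eigenvectors_independent[OF T fin eig nz _ i] unfolding v_def by blast
qed

end

theorem mainTheorem8:
  fixes scale :: "complex \<Rightarrow> 'a::ab_group_add \<Rightarrow> 'a"
    and mul :: "'a \<Rightarrow> 'a \<Rightarrow> 'a"
    and H :: "'a set"
    and e\<^sub>0 :: 'a
    and e :: "complex \<Rightarrow> 'a"
    and c :: "complex \<Rightarrow> complex \<Rightarrow> complex"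
    and \<Lambda> :: "complex set"
    and \<alpha> :: complex
  assumes lsa: "left_symmetric_algebra scale mul"
    and nonzero: "\<exists>x::'a. x \<noteq> 0"
    and complete: "left_symmetric_algebra.complete_lsa scale mul"
    and canonical: "left_symmetric_algebra.canonical_cartan scale mul H"
    and dim_le_1: "\<And>\<phi>. left_symmetric_algebra.functional_on scale H \<phi> \<Longrightarrow>
        vector_space.dim scale (left_symmetric_algebra.root_subspace scale mul H \<phi>) \<le> 1"
    and e\<^sub>0: "e\<^sub>0 \<in> H" "e\<^sub>0 \<noteq> 0"
    and \<Lambda>: "\<Lambda> = left_symmetric_algebra.Spec scale mul H e\<^sub>0"
    and base: "left_symmetric_algebra.root_base scale mul H e\<^sub>0 e"
    and constants: "left_symmetric_algebra.structure_constants scale mul \<Lambda> e c"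
    and \<alpha>: "\<alpha> \<in> \<Lambda>"
  shows "card {\<mu> \<in> \<Lambda>. \<mu> - 2 * \<alpha> \<in> \<Lambda> \<and> \<mu> - \<alpha> \<in> \<Lambda> \<and>
            (\<mu>, \<mu> - 2 * \<alpha>) \<in> parcs (Gamma_r \<Lambda> c) \<and>
            (\<mu> - 2 * \<alpha>, \<mu> - \<alpha>) \<in> parcs (Gamma_r \<Lambda> c) \<and>
            (\<mu> - \<alpha>, \<mu>) \<in> parcs (Gamma_r \<Lambda> c)} \<noteq> 1"
proof
  interpret left_symmetric_algebra scale mul by (rule lsa)
  let ?path = "\<lambda>\<mu>. \<mu> - 2 * \<alpha> \<in> \<Lambda> \<and> \<mu> - \<alpha> \<in> \<Lambda> \<and>
            (\<mu>, \<mu> - 2 * \<alpha>) \<in> parcs (Gamma_r \<Lambda> c) \<and>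
            (\<mu> - 2 * \<alpha>, \<mu> - \<alpha>) \<in> parcs (Gamma_r \<Lambda> c) \<and>
            (\<mu> - \<alpha>, \<mu>) \<in> parcs (Gamma_r \<Lambda> c)"
  assume "card {\<mu> \<in> \<Lambda>. ?path \<mu>} = 1"
  then obtain \<mu> where \<mu>: "{\<mu> \<in> \<Lambda>. ?path \<mu>} = {\<mu>}" by (rule card_1_singletonE)
  have eig: "mul e\<^sub>0 (e i) = scale i (e i)" and nz: "e i \<noteq> 0" if "i \<in> \<Lambda>" for i
    using that base by (auto simp: \<Lambda> Spec_def root_base_def)
  have off: "e i = 0" if "i \<notin> \<Lambda>" for i
    using that base by (simp add: \<Lambda> root_base_def)
  have mul_e: "mul (e i) (e j) = scale (c i j) (e (i + j))" for i j
    using constants by (simp add: structure_constants_def)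
  have fin: "finite \<Lambda>" by (rule finite_eigenvalues[OF linear_right eig nz])
  define R where "R \<gamma> i j = (if i = j + \<gamma> then c j \<gamma> else 0)" for \<gamma> i j
  \<comment> \<open>The diagonal entry at \<open>i\<close> of the product of the three matrices; the factors are the structure
    constants of the edges of a path from \<open>i\<close> back to \<open>i\<close>, last edge first.\<close>
  define loop where "loop i = c (i - \<alpha>) \<alpha> * c (i - 2 * \<alpha>) \<alpha> * c i (- 2 * \<alpha>)" for i
  have path_iff: "?path i \<longleftrightarrow> i - 2 * \<alpha> \<in> \<Lambda> \<and> i - \<alpha> \<in> \<Lambda> \<and> loop i \<noteq> 0" if "i \<in> \<Lambda>" for i
    using that by (auto simp: Gamma_r_def loop_def)
  have diag: "(\<Sum>j\<in>\<Lambda>. \<Sum>k\<in>\<Lambda>. R \<alpha> i j * R \<alpha> j k * R (- 2 * \<alpha>) k i)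
      = (if i - 2 * \<alpha> \<in> \<Lambda> \<and> i - \<alpha> \<in> \<Lambda> then loop i else 0)" for i
  proof -
    have "(\<Sum>k\<in>\<Lambda>. R \<alpha> i j * R \<alpha> j k * R (- 2 * \<alpha>) k i)
        = (\<Sum>k\<in>\<Lambda>. if k = i - 2 * \<alpha> then if j = i - \<alpha> then loop i else 0 else 0)" for j
      by (intro sum.cong) (auto simp: R_def loop_def)
    then have "(\<Sum>j\<in>\<Lambda>. \<Sum>k\<in>\<Lambda>. R \<alpha> i j * R \<alpha> j k * R (- 2 * \<alpha>) k i)
        = (\<Sum>j\<in>\<Lambda>. if j = i - \<alpha> then if i - 2 * \<alpha> \<in> \<Lambda> then loop i else 0 else 0)"
      using fin by (intro sum.cong) simp_all
    then show ?thesis using fin by simp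
  qed
  have "0 = (\<Sum>i\<in>\<Lambda>. \<Sum>j\<in>\<Lambda>. \<Sum>k\<in>\<Lambda>. R \<alpha> i j * R \<alpha> j k * R (- 2 * \<alpha>) k i)"
    unfolding R_def
    by (rule mixed_trace_right_mul_eq_0[symmetric, OF complete linear_right eig nz off mul_e])
  also have "\<dots> = (\<Sum>i\<in>\<Lambda>. if i = \<mu> then loop \<mu> else 0)"
    unfolding diag
  proof (rule sum.cong[OF refl])
    fix i assume i: "i \<in> \<Lambda>"
    have "?path i \<longleftrightarrow> i = \<mu>" using \<mu> i by blast
    then show "(if i - 2 * \<alpha> \<in> \<Lambda> \<and> i - \<alpha> \<in> \<Lambda> then loop i else 0) = (if i = \<mu> then loop \<mu> else 0)"
      unfolding path_iff[OF i] by auto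
  qed
  also have "\<dots> = loop \<mu>" using \<mu> fin by auto
  finally have "loop \<mu> = 0" by simp
  moreover have "\<mu> \<in> \<Lambda>" "?path \<mu>" using \<mu> by blast+
  ultimately show False using path_iff by blast
qed

end
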